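(* Let $d\ge 1$, $\mathcal X_\bullet=\{x\in\mathbb R^d:\|x\|_2\le 1\}$ and $\mathcal Y_\circ=\{q\in\mathbb R^d:\|q\|_2=1\}$. For $x\in\mathbb R^d$ with $\|x\|_2\le 1$ let $P(x)=\big[x;\sqrt{1-\|x\|_2^2}\big]\in\mathbb R^{d+1}$, and let SIMPLE-LSH be the random function $h_a(x)=\mathrm{sign}(a^\top P(x))\in\{\pm1\}$, where $a\sim\mathcal N(0,I_{d+1})$. Then SIMPLE-LSH is a universal LSH for the inner product similarity $\mathrm{sim}(x,q)=x^\top q$ over $\mathcal X_\bullet,\mathcal Y_\circ$; that is, for every $0<S<1$ and $0<c<1$ it is an $(S,cS)$-LSH over $\mathcal X_\bullet,\mathcal Y_\circ$. Furthermore, for each such $S,c$ it has hashing quality $$\rho=\frac{\log\left(1-\frac{\cos^{-1}(S)}{\pi}\right)}{\log\left(1-\frac{\cos^{-1}(cS)}{\pi}\right)}.$$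
   Context: A hash of a set $\mathcal Z$ is a probability distribution over functions $h:\mathcal Z\to\Gamma$, where $\Gamma$ is some set (the alphabet). For $\mathcal X,\mathcal Y\subseteq\mathcal Z$ and a similarity function $\mathrm{sim}$, a hash is an $(S,cS,p_1,p_2)$-LSH for $\mathrm{sim}$ over $\mathcal X,\mathcal Y$ if for all $x\in\mathcal X$, $y\in\mathcal Y$: (i) if $\mathrm{sim}(x,y)\ge S$ then $\mathbb P_h[h(x)=h(y)]\ge p_1$; (ii) if $\mathrm{sim}(x,y)\le cS$ then $\mathbb P_h[h(x)=h(y)]\le p_2$. It is an $(S,cS)$-LSH if there exist $p_1,p_2\in[0,1]$ with $p_1>p_2$ such that it is an $(S,cS,p_1,p_2)$-LSH. The hashing quality of an $(S,cS,p_1,p_2)$-LSH is $\rho=\frac{\log p_1}{\log p_2}$; "has hashing quality $\rho$" (for given $S,c$) means that it is an $(S,cS,p_1,p_2)$-LSH for some $p_1>p_2$ with $\frac{\log p_1}{\log p_2}=\rho$. The notation $[u;v]$ denotes concatenation of vectors; $\mathrm{sign}(t)=1$ for $t\geq 0$ and $-1$ for $t<0$ (the value at $0$ is immaterial). *)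

theory Defs
  imports "HOL-Probability.Probability"
begin

section \<open>Locality sensitive hashing\<close>

text \<open>
  A hash of \<open>Z\<close> is a probability distribution over functions \<open>Z \<rightarrow> \<Gamma>\<close> for some alphabet \<open>\<Gamma>\<close>.
  Functions on \<open>Z\<close> are represented extensionally (undefined outside \<open>Z\<close>).  Collision events
  have to be measurable, as otherwise their probability is meaningless.
\<close>

definition is_hash :: "'z set \<Rightarrow> ('z \<Rightarrow> 'g) measure \<Rightarrow> bool" where
  "is_hash Z H \<longleftrightarrow>
     prob_space H \<and> (\<exists>\<Gamma>. space H = (Z \<rightarrow>\<^sub>E \<Gamma>)) \<and>
     (\<forall>x\<in>Z. \<forall>y\<in>Z. {h \<in> space H. h x = h y} \<in> sets H)"

text \<open>The argument \<open>cS\<close> is the lower threshold itself, not the factor \<open>c\<close>.\<close>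

definition is_LSH_with ::
  "'z set \<Rightarrow> ('z \<Rightarrow> 'g) measure \<Rightarrow> ('z \<Rightarrow> 'z \<Rightarrow> real) \<Rightarrow> 'z set \<Rightarrow> 'z set \<Rightarrow>
   real \<Rightarrow> real \<Rightarrow> real \<Rightarrow> real \<Rightarrow> bool" where
  "is_LSH_with Z H sim X Y S cS p1 p2 \<longleftrightarrow>
     is_hash Z H \<and> X \<subseteq> Z \<and> Y \<subseteq> Z \<and>
     (\<forall>x\<in>X. \<forall>y\<in>Y.
        (sim x y \<ge> S \<longrightarrow> \<P>(h in H. h x = h y) \<ge> p1) \<and>
        (sim x y \<le> cS \<longrightarrow> \<P>(h in H. h x = h y) \<le> p2))"

definition is_LSH ::
  "'z set \<Rightarrow> ('z \<Rightarrow> 'g) measure \<Rightarrow> ('z \<Rightarrow> 'z \<Rightarrow> real) \<Rightarrow> 'z set \<Rightarrow> 'z set \<Rightarrow>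
   real \<Rightarrow> real \<Rightarrow> bool" where
  "is_LSH Z H sim X Y S cS \<longleftrightarrow>
     (\<exists>p1\<in>{0..1}. \<exists>p2\<in>{0..1}. p1 > p2 \<and> is_LSH_with Z H sim X Y S cS p1 p2)"

text \<open>
  The side condition \<open>0 < p2\<close> keeps both logarithms away from the convention \<open>ln 0 = 0\<close>;
  together with \<open>p2 < p1 \<le> 1\<close> it also makes the denominator nonzero.
\<close>

definition has_hashing_quality ::
  "'z set \<Rightarrow> ('z \<Rightarrow> 'g) measure \<Rightarrow> ('z \<Rightarrow> 'z \<Rightarrow> real) \<Rightarrow> 'z set \<Rightarrow> 'z set \<Rightarrow>
   real \<Rightarrow> real \<Rightarrow> real \<Rightarrow> bool" where
  "has_hashing_quality Z H sim X Y S cS \<rho> \<longleftrightarrow>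
     (\<exists>p1\<in>{0..1}. \<exists>p2\<in>{0..1}. p1 > p2 \<and> p2 > 0 \<and>
        is_LSH_with Z H sim X Y S cS p1 p2 \<and> ln p1 / ln p2 = \<rho>)"

definition universal_LSH ::
  "'z set \<Rightarrow> ('z \<Rightarrow> 'g) measure \<Rightarrow> ('z \<Rightarrow> 'z \<Rightarrow> real) \<Rightarrow> 'z set \<Rightarrow> 'z set \<Rightarrow> bool" where
  "universal_LSH Z H sim X Y \<longleftrightarrow>
     (\<forall>S c. 0 < S \<and> S < 1 \<and> 0 < c \<and> c < 1 \<longrightarrow> is_LSH Z H sim X Y S (c * S))"


section \<open>SIMPLE-LSH\<close>

text \<open>The concatenation \<open>[u; v]\<close>; the index type \<open>'m + 'n\<close> has \<open>CARD('m) + CARD('n)\<close> elements.\<close>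

definition vec_concat :: "real ^ 'm \<Rightarrow> real ^ 'n \<Rightarrow> real ^ ('m + 'n)" where
  "vec_concat u v = (\<chi> i. case i of Inl j \<Rightarrow> u $ j | Inr k \<Rightarrow> v $ k)"

text \<open>The transformation \<open>P\<close>; it is only meaningful on the closed unit ball.\<close>

definition simple_P :: "real ^ 'd \<Rightarrow> real ^ ('d + 1)" where
  "simple_P x = vec_concat x (vec (sqrt (1 - (norm x)\<^sup>2)))"

text \<open>\<open>sgn\<close> is not used, since \<open>sgn 0 = 0\<close>.\<close>

definition sign :: "real \<Rightarrow> int" where
  "sign t = (if t \<ge> 0 then 1 else - 1)"

text \<open>\<open>N(0, I)\<close>: the coordinates are independent standard normal variables.\<close>

definition std_gaussian :: "(real ^ 'n) measure" where
  "std_gaussian = density lborel (\<lambda>a. ennreal (\<Prod>i\<in>UNIV. std_normal_density (a $ i)))"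

definition simple_hash :: "real ^ ('d + 1) \<Rightarrow> real ^ 'd \<Rightarrow> int" where
  "simple_hash a = (\<lambda>x\<in>cball 0 1. sign (a \<bullet> simple_P x))"

text \<open>
  The law of the random function \<open>simple_hash a\<close> on \<open>cball 0 1 \<rightarrow> {- 1, 1}\<close>, with the product
  \<open>\<sigma>\<close>-algebra.
\<close>

definition simple_LSH :: "(real ^ 'd \<Rightarrow> int) measure" where
  "simple_LSH = distr std_gaussian (\<Pi>\<^sub>M x\<in>cball 0 1. count_space {- 1, 1}) simple_hash"

end

theory Submission imports Defs begin

text \<open>
  The map \<open>P\<close> sends the ball to the unit sphere and satisfies \<open>P x \<bullet> P q = x \<bullet> q\<close> whenever
  \<open>norm q = 1\<close>, so everything reduces to \<open>\<P>(sign (a \<bullet> u) = sign (a \<bullet> w)) = 1 - arccos (u \<bullet> w) / pi\<close>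
  for unit vectors \<open>u\<close>, \<open>w\<close>.  No Gaussian integral over a wedge is needed for this: by rotation
  invariance the probability of disagreement depends on the angle only, it is additive in the angle,
  and the values at \<open>t\<close> and \<open>pi - t\<close> sum to 1, since a sign almost surely flips under
  \<open>u \<mapsto> - u\<close>.  The only such nonnegative function of \<open>t\<close> is \<open>t / pi\<close>.  The collision probability
  is then strictly increasing in \<open>x \<bullet> q\<close>.
\<close>

section \<open>Rotation invariance of Lebesgue measure and of the Gaussian\<close>

lemma orthogonal_transformation_measurable:
  fixes T :: "'a::euclidean_space \<Rightarrow> 'a"
  assumes "orthogonal_transformation T"
  shows "T \<in> borel \<rightarrow>\<^sub>M borel"
  using orthogonal_transformation_linear[OF assms]
  by (intro borel_measurable_continuous_onI linear_continuous_on)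
    (simp add: linear_conv_bounded_linear)

text \<open>
  The change of variables theorem of the library for linear maps on \<open>real ^ 'n\<close> requires
  \<open>'n\<close> to be well-ordered, which \<open>'d + 1\<close> is not.  As in the uniqueness proof for Haar measure,
  integrate \<open>indicator A x * indicator B (x - T y)\<close> in both orders, with \<open>B\<close> the unit ball.
\<close>
lemma distr_lborel_orthogonal_transformation:
  fixes T :: "'a::euclidean_space \<Rightarrow> 'a"
  assumes T: "orthogonal_transformation T"
  shows "distr lborel borel T = lborel"
proof (rule measure_eqI)
  have lin: "linear T" and norm_T: "\<And>x. norm (T x) = norm x"
    using T by (auto simp: orthogonal_transformation)
  note [measurable] = orthogonal_transformation_measurable[OF T]
  fix A assume "A \<in> sets (distr lborel borel T)"
  then have A[measurable]: "A \<in> sets borel" by simp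
  \<comment> \<open>\<open>B\<close> is symmetric, \<open>T\<close>-invariant and of finite positive
    volume, so both orders of integration produce the same factor, which cancels at the end.\<close>
  define B where "B = ball (0::'a) 1"
  have [measurable]: "B \<in> sets borel" by (simp add: B_def)
  have shift: "(\<integral>\<^sup>+y. g (z + y) \<partial>lborel) = (\<integral>\<^sup>+y. g y \<partial>lborel)"
    if [measurable]: "g \<in> borel_measurable borel" for g :: "'a \<Rightarrow> ennreal" and z
    by (subst (2) lborel_distr_plus[of z, symmetric]) (simp add: nn_integral_distr)
  \<comment> \<open>Surjectivity turns a translation by \<open>x\<close> into one by a preimage
    \<open>z\<close> under \<open>T\<close>, so the pushforward along \<open>T\<close> is again
    translation invariant.\<close>
  have T_shift: "(\<integral>\<^sup>+y. g (x + T y) \<partial>lborel) = (\<integral>\<^sup>+y. g (T y) \<partial>lborel)"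
    if [measurable]: "g \<in> borel_measurable borel" for g :: "'a \<Rightarrow> ennreal" and x
  proof -
    obtain z where "x = T z"
      using orthogonal_transformation_surj[OF T] by (metis surjD)
    then show ?thesis
      using shift[of "\<lambda>y. g (T y)" z] by (simp add: linear_add[OF lin])
  qed
  have "emeasure lborel A * emeasure lborel B
      = (\<integral>\<^sup>+x. indicator A x * emeasure lborel B \<partial>lborel)"
    by (simp add: nn_integral_multc)
  also have "\<dots> = (\<integral>\<^sup>+x. indicator A x * (\<integral>\<^sup>+y. indicator B (x - T y) \<partial>lborel) \<partial>lborel)"
  proof (intro nn_integral_cong arg_cong2[where f = "(*)"] refl)
    fix x
    have "(\<integral>\<^sup>+y. indicator B (x - T y) \<partial>lborel)
        = (\<integral>\<^sup>+y. indicator B (- T y) \<partial>(lborel :: 'a measure))"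
      using T_shift[of "\<lambda>y. indicator B (- y)" "- x"] by simp
    also have "\<dots> = (\<integral>\<^sup>+y. indicator B y \<partial>(lborel :: 'a measure))"
      by (intro nn_integral_cong) (simp add: B_def norm_T indicator_def)
    finally show "emeasure lborel B = (\<integral>\<^sup>+y. indicator B (x - T y) \<partial>lborel)"
      by simp
  qed
  also have "\<dots> = (\<integral>\<^sup>+x. (\<integral>\<^sup>+y. indicator A x * indicator B (x - T y) \<partial>lborel) \<partial>lborel)"
    by (simp add: nn_integral_cmult)
  also have "\<dots> = (\<integral>\<^sup>+y. (\<integral>\<^sup>+x. indicator A x * indicator B (x - T y) \<partial>lborel) \<partial>lborel)"
    by (rule lborel_pair.Fubini') measurable
  \<comment> \<open>Substitute \<open>x + T y\<close> for \<open>x\<close>; after the second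
    exchange, \<open>T_shift\<close> absorbs the remaining shift by \<open>x\<close>.\<close>
  also have "\<dots> = (\<integral>\<^sup>+y. (\<integral>\<^sup>+x. indicator A (x + T y) * indicator B x \<partial>lborel) \<partial>lborel)"
  proof (rule nn_integral_cong)
    fix y
    show "(\<integral>\<^sup>+x. indicator A x * indicator B (x - T y) \<partial>lborel) =
        (\<integral>\<^sup>+x. indicator A (x + T y) * indicator B x \<partial>lborel)"
      using shift[of "\<lambda>x. indicator A x * indicator B (x - T y)" "T y"]
      by (simp add: add.commute)
  qed
  also have "\<dots> = (\<integral>\<^sup>+x. (\<integral>\<^sup>+y. indicator A (x + T y) * indicator B x \<partial>lborel) \<partial>lborel)"
    by (rule lborel_pair.Fubini') measurable
  also have "\<dots> = (\<integral>\<^sup>+x. (\<integral>\<^sup>+y. indicator A (T y) \<partial>(lborel :: 'a measure)) * indicator B x \<partial>lborel)"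
    by (intro nn_integral_cong) (simp add: nn_integral_multc T_shift[of "indicator A"])
  also have "\<dots> = (\<integral>\<^sup>+y. indicator A (T y) \<partial>(lborel :: 'a measure)) * emeasure lborel B"
    by (simp add: nn_integral_cmult)
  also have "(\<integral>\<^sup>+y. indicator A (T y) \<partial>(lborel :: 'a measure)) = emeasure (distr lborel borel T) A"
    by (subst nn_integral_distr[of T lborel borel "indicator A", symmetric]) auto
  finally have "emeasure lborel B * emeasure lborel A
      = emeasure lborel B * emeasure (distr lborel borel T) A"
    by (simp add: mult.commute)
  moreover have "emeasure lborel B \<noteq> \<infinity>"
    using emeasure_lborel_ball_finite[of 0 1] by (simp add: B_def less_top)
  moreover have "emeasure lborel B \<noteq> 0"
    by (simp add: B_def emeasure_ball less_imp_neq[OF unit_ball_vol_pos, THEN not_sym])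
  ultimately show "emeasure (distr lborel borel T) A = emeasure lborel A"
    by (simp add: ennreal_mult_cancel_left)
qed simp

text \<open>In this form the density depends on \<open>a\<close> only through its norm, which
  orthogonal maps preserve.\<close>

lemma prod_std_normal_density:
  fixes a :: "real ^ 'n"
  shows "(\<Prod>i\<in>UNIV. std_normal_density (a $ i))
    = (1 / sqrt (2 * pi)) ^ CARD('n) * exp (- (norm a)\<^sup>2 / 2)"
proof -
  have "(\<Sum>i\<in>UNIV. - (a $ i)\<^sup>2 / 2) = - (norm a)\<^sup>2 / 2"
    unfolding power2_norm_eq_inner inner_vec_def
    by (simp add: power2_eq_square sum_negf sum_divide_distrib)
  then have "(\<Prod>i\<in>UNIV. exp (- (a $ i)\<^sup>2 / 2)) = exp (- (norm a)\<^sup>2 / 2)"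
    by (metis exp_sum finite)
  then show ?thesis
    unfolding std_normal_density_def prod.distrib prod_constant by simp
qed

lemma sets_std_gaussian [simp, measurable_cong]: "sets std_gaussian = sets borel"
  and space_std_gaussian [simp]: "space std_gaussian = UNIV"
  by (simp_all add: std_gaussian_def)

lemma std_gaussian_altdef:
  "(std_gaussian :: (real ^ 'n) measure)
    = density lborel (\<lambda>a. ennreal ((1 / sqrt (2 * pi)) ^ CARD('n) * exp (- (norm a)\<^sup>2 / 2)))"
  by (simp add: std_gaussian_def prod_std_normal_density)

lemma distr_std_gaussian_orthogonal_transformation:
  fixes T :: "real ^ 'n \<Rightarrow> real ^ 'n"
  assumes T: "orthogonal_transformation T"
  shows "distr std_gaussian borel T = std_gaussian"
proof -
  define g where
    "g = (\<lambda>a :: real ^ 'n. ennreal ((1 / sqrt (2 * pi)) ^ CARD('n) * exp (- (norm a)\<^sup>2 / 2)))"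
  note [measurable] = orthogonal_transformation_measurable[OF T]
  have [measurable]: "g \<in> borel_measurable borel"
    by (simp add: g_def)
  have "std_gaussian = density (distr lborel borel T) g"
    by (simp add: distr_lborel_orthogonal_transformation[OF T] std_gaussian_altdef g_def)
  also have "\<dots> = distr (density lborel (\<lambda>a. g (T a))) borel T"
    by (rule density_distr) measurable
  also have "(\<lambda>a. g (T a)) = g"
    using T by (simp add: g_def orthogonal_transformation)
  finally show ?thesis
    by (simp add: std_gaussian_altdef g_def)
qed

lemma prob_space_std_gaussian: "prob_space (std_gaussian :: (real ^ 'n) measure)"
proof
  \<comment> \<open>Coordinates become inner products with basis vectors, so that the integral
    factors over \<open>Basis\<close> into one-dimensional ones.\<close>
  have axis: "inj (\<lambda>i::'n. axis i (1::real))" "Basis = range (\<lambda>i::'n. axis i (1::real))"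
    by (auto simp: inj_def axis_eq_axis Basis_vec_def)
  have one: "(\<integral>\<^sup>+x. ennreal (std_normal_density x) \<partial>lborel) = 1"
    by (simp add: nn_integral_eq_integral)
  have "emeasure (std_gaussian :: (real ^ 'n) measure) UNIV
      = (\<integral>\<^sup>+a. ennreal (\<Prod>i\<in>UNIV. std_normal_density (a $ i)) \<partial>(lborel :: (real ^ 'n) measure))"
    by (simp add: std_gaussian_def emeasure_density)
  also have "\<dots> = (\<integral>\<^sup>+a. (\<Prod>b\<in>Basis. ennreal (std_normal_density (a \<bullet> b))) \<partial>(lborel :: (real ^ 'n) measure))"
    unfolding axis(2) by (simp add: prod.reindex[OF axis(1)] inner_axis prod_ennreal)
  also have "\<dots> = 1"
    by (subst nn_integral_lborel_prod) (auto simp: one)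
  finally show "emeasure std_gaussian (space (std_gaussian :: (real ^ 'n) measure)) = 1"
    by simp
qed

text \<open>The hyperplane orthogonal to \<open>v\<close> is Lebesgue null and the Gaussian has a
  density. This discards the vectors at which \<open>sign\<close> fails to be odd.\<close>

lemma AE_std_gaussian_inner_nonzero:
  fixes v :: "real ^ 'n"
  assumes "v \<noteq> 0"
  shows "AE a in std_gaussian. a \<bullet> v \<noteq> 0"
proof -
  have "{a. v \<bullet> a = 0} \<in> null_sets lebesgue"
    using negligible_hyperplane[of v 0] assms by (simp add: negligible_iff_null_sets)
  then have "{a. v \<bullet> a = 0} \<in> null_sets lborel"
    by (simp add: null_sets_completion_iff closed_hyperplane borel_closed)
  then have "AE a in lborel. a \<bullet> v \<noteq> 0"
    using AE_not_in[of "{a. v \<bullet> a = 0}" lborel] by (simp add: inner_commute)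
  then show ?thesis
    unfolding std_gaussian_altdef by (subst AE_density) auto
qed

section \<open>Rotations of a plane and a functional equation for the angle\<close>

text \<open>For orthonormal \<open>u\<close>, \<open>v\<close>: the point at angle \<open>t\<close>
  on the unit circle of their plane, counted from \<open>u\<close> towards \<open>v\<close>.\<close>

definition plane_dir :: "'a::real_inner \<Rightarrow> 'a \<Rightarrow> real \<Rightarrow> 'a" where
  "plane_dir u v t = cos t *\<^sub>R u + sin t *\<^sub>R v"

lemma norm_plane_dir:
  assumes "norm u = 1" "norm v = 1" "u \<bullet> v = 0"
  shows "norm (plane_dir u v t) = 1"
proof -
  have "u \<bullet> u = 1" "v \<bullet> v = 1" "v \<bullet> u = 0"
    using assms by (auto simp: norm_eq_1 inner_commute)
  then have "plane_dir u v t \<bullet> plane_dir u v t = (cos t)\<^sup>2 + (sin t)\<^sup>2"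
    using assms(3)
    by (simp add: plane_dir_def inner_add_left inner_add_right power2_eq_square)
  then show ?thesis
    by (simp add: norm_eq_1)
qed

text \<open>Rotate the plane of \<open>u\<close> and \<open>v\<close> by \<open>s\<close> and fix
  its orthogonal complement.\<close>

lemma plane_rotation_exists:
  fixes u v :: "'a::real_inner"
  assumes uv: "norm u = 1" "norm v = 1" "u \<bullet> v = 0"
  obtains T where "orthogonal_transformation T"
    "\<And>t. T (plane_dir u v t) = plane_dir u v (s + t)"
proof -
  have ip: "u \<bullet> u = 1" "v \<bullet> v = 1" "u \<bullet> v = 0" "v \<bullet> u = 0"
    using uv by (auto simp: norm_eq_1 inner_commute)
  define c where "c = cos s"
  define d where "d = sin s"
  have cd: "c * c + d * d = 1"
    by (simp add: c_def d_def flip: power2_eq_square)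
  \<comment> \<open>The correction added to \<open>x\<close> is the rotation matrix minus the
    identity, applied to the coordinates of \<open>x\<close> along \<open>u\<close> and
    \<open>v\<close>.\<close>
  define T where "T = (\<lambda>x. x + ((c - 1) * (x \<bullet> u) - d * (x \<bullet> v)) *\<^sub>R u
    + (d * (x \<bullet> u) + (c - 1) * (x \<bullet> v)) *\<^sub>R v)"
  have "linear T"
    by (rule linearI) (simp_all add: T_def inner_add_left algebra_simps)
  moreover have "T x \<bullet> T y = x \<bullet> y" for x y
  proof -
    define p q p' q' where "p = x \<bullet> u" "q = x \<bullet> v" "p' = y \<bullet> u" "q' = y \<bullet> v"
    have "T x \<bullet> T y = x \<bullet> y + ((c - 1) * p' - d * q') * p + (d * p' + (c - 1) * q') * q
        + ((c - 1) * p - d * q) * p' + (d * p + (c - 1) * q) * q'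
        + ((c - 1) * p - d * q) * ((c - 1) * p' - d * q')
        + (d * p + (c - 1) * q) * (d * p' + (c - 1) * q')"
      by (simp add: T_def inner_add_left inner_add_right ip p_q_p'_q'_def inner_commute)
    also have "\<dots> = x \<bullet> y + (c * c + d * d - 1) * (p * p' + q * q')"
      by algebra
    finally show ?thesis
      by (simp add: cd)
  qed
  ultimately have "orthogonal_transformation T"
    by (simp add: orthogonal_transformation_def)
  moreover have "T (plane_dir u v t) = plane_dir u v (s + t)" for t
  proof -
    have "T (plane_dir u v t) = (c * cos t - d * sin t) *\<^sub>R u + (d * cos t + c * sin t) *\<^sub>R v"
      by (simp add: T_def plane_dir_def inner_add_left ip algebra_simps)
    then show ?thesis
      by (simp add: plane_dir_def c_def d_def cos_add sin_add)
  qed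
  ultimately show ?thesis
    by (rule that)
qed

text \<open>
  Monotonicity between multiples of \<open>pi / n\<close> traps \<open>f t - t / pi\<close> in an interval of length \<open>1 / n\<close>.
\<close>
lemma additive_complementary_eq_linear:
  fixes f :: "real \<Rightarrow> real"
  assumes nonneg: "\<And>t. 0 \<le> f t"
    and add: "\<And>s t. 0 \<le> s \<Longrightarrow> 0 \<le> t \<Longrightarrow> s + t < pi \<Longrightarrow> f (s + t) = f s + f t"
    and compl: "\<And>t. 0 \<le> t \<Longrightarrow> t \<le> pi \<Longrightarrow> f t + f (pi - t) = 1"
    and t: "0 \<le> t" "t \<le> pi"
  shows "f t = t / pi"
proof (cases "t = pi")
  case True
  \<comment> \<open>Additivity is given only for sums below \<open>pi\<close>, so the endpoint comes
    from the complement rule at \<open>pi\<close>.\<close>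
  have "f 0 = 0"
    using add[of 0 0] by simp
  then show ?thesis
    using compl[of pi] True by simp
next
  case False
  then have "t < pi" using t by simp
  have mono: "f a \<le> f b" if "0 \<le> a" "a \<le> b" "b < pi" for a b
    using add[of a "b - a"] nonneg[of "b - a"] that by simp
  have bound: "\<bar>f t - t / pi\<bar> \<le> 1 / real n" if n: "n > 0" for n :: nat
  proof -
    define h where "h = pi / real n"
    have h: "0 < h" "real n * h = pi"
      using n by (auto simp: h_def)
    \<comment> \<open>The bound \<open>k < n\<close> keeps every partial sum below
      \<open>pi\<close>, where additivity applies.\<close>
    have mult: "f (real k * h) = real k * f h" if "k < n" for k
      using that
    proof (induction k)
      case 0
      then show ?case using add[of 0 0] by simp
    next
      case (Suc k)
      have "real (Suc k) * h < real n * h"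
        using Suc.prems h by (intro mult_strict_right_mono) auto
      then have "f (real k * h + h) = f (real k * h) + f h"
        using h by (intro add) (auto simp: algebra_simps)
      then show ?case
        using Suc by (simp add: algebra_simps)
    qed
    have "f h + f (pi - h) = 1"
      using h n by (intro compl) (auto simp: h_def field_simps)
    \<comment> \<open>The complement of \<open>h\<close> is the last multiple that
      \<open>mult\<close> reaches; this fixes \<open>f h\<close> without evaluating \<open>f\<close>
      at \<open>pi\<close>.\<close>
    moreover have "pi - h = real (n - 1) * h"
      using h n by (simp add: algebra_simps of_nat_diff)
    ultimately have "f h + real (n - 1) * f h = 1"
      using mult[of "n - 1"] n by simp
    then have "real n * f h = 1"
      using n by (simp add: algebra_simps of_nat_diff)
    then have fh: "f h = 1 / real n"
      using n by (simp add: field_simps)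
    \<comment> \<open>\<open>t\<close> lies between the consecutive multiples \<open>k * h\<close>
      and \<open>(k + 1) * h\<close>.\<close>
    define k where "k = nat \<lfloor>t / h\<rfloor>"
    have k: "real k \<le> t / h" "t / h < real k + 1"
      using t h unfolding k_def by auto
    have tn: "t / h < real n"
      using \<open>t < pi\<close> h by (simp add: divide_less_eq)
    have "k < n"
      using k tn by linarith
    have th: "t / h = t / pi * real n"
      by (simp add: h_def)
    have kt: "real k * h \<le> t" "t < (real k + 1) * h"
      using k h by (auto simp: field_simps)
    have low: "real k / real n \<le> f t"
      using mono[of "real k * h" t] kt \<open>t < pi\<close> h mult[OF \<open>k < n\<close>] fh by simp
    have up: "f t \<le> (real k + 1) / real n"
    proof (cases "Suc k < n")
      case True
      have "real (Suc k) * h < real n * h"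
        using True h by (intro mult_strict_right_mono) auto
      then show ?thesis
        using mono[of t "real (Suc k) * h"] mult[OF True] kt t h fh by (simp add: add.commute)
    next
      case False
      \<comment> \<open>The next multiple would be \<open>pi\<close>, where \<open>mono\<close> does
        not apply; the bound \<open>f t \<le> 1\<close> takes its place.\<close>
      then have "real n = real k + 1"
        using \<open>k < n\<close> by linarith
      moreover have "f t \<le> 1"
        using compl[of t] nonneg[of "pi - t"] t by simp
      ultimately show ?thesis by simp
    qed
    have "real k / real n \<le> t / pi" "t / pi \<le> (real k + 1) / real n"
      using k n unfolding th by (auto simp: field_simps)
    then show ?thesis
      using low up by (simp add: add_divide_distrib abs_le_iff)
  qed
  have "\<bar>f t - t / pi\<bar> \<le> e" if "e > 0" for e
  proof -
    obtain n where "1 / real (Suc n) < e"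
      using \<open>e > 0\<close> by (rule nat_approx_posE)
    then show ?thesis
      using bound[of "Suc n"] by simp
  qed
  then show ?thesis
    using field_le_epsilon[of "\<bar>f t - t / pi\<bar>" 0] by simp
qed

section \<open>Signs of a Gaussian vector along two directions\<close>

lemma sign_uminus: "x \<noteq> 0 \<Longrightarrow> sign (- x) = - sign x"
  by (auto simp: sign_def)

lemma borel_measurable_sign [measurable]: "sign \<in> borel \<rightarrow>\<^sub>M count_space UNIV"
  unfolding sign_def by measurable

lemma measure_sign_disagree:
  fixes u v :: "real ^ 'n"
  assumes uv: "norm u = 1" "norm v = 1" "u \<bullet> v = 0" and t: "0 \<le> t" "t \<le> pi"
  shows "measure std_gaussian {a. sign (a \<bullet> u) \<noteq> sign (a \<bullet> plane_dir u v t)} = t / pi"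
proof -
  interpret prob_space "std_gaussian :: (real ^ 'n) measure"
    by (rule prob_space_std_gaussian)
  let ?w = "plane_dir u v"
  \<comment> \<open>The event that the directions at angles \<open>r\<close> and \<open>s\<close>
    receive different signs.\<close>
  define D where "D = (\<lambda>r s. {a. sign (a \<bullet> ?w r) \<noteq> sign (a \<bullet> ?w s)})"
  define f where "f = (\<lambda>t. prob (D 0 t))"
  have D_sets [measurable]: "D r s \<in> sets borel" for r s
    unfolding D_def by measurable
  have w0: "?w 0 = u" and wpi: "?w pi = - u"
    by (simp_all add: plane_dir_def)
  have rotate: "prob (D s (s + t)) = f t" for s t
  proof -
    obtain T where T: "orthogonal_transformation T" "\<And>t. T (?w t) = ?w (s + t)"
      using plane_rotation_exists[OF uv] by metis
    note [measurable] = orthogonal_transformation_measurable[OF T(1)]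
    \<comment> \<open>Rotating both the vector and the direction keeps the inner product, so the
      event for angles \<open>s\<close>, \<open>s + t\<close> pulls back to the one for
      \<open>0\<close>, \<open>t\<close>.\<close>
    have "T a \<bullet> ?w (s + r) = a \<bullet> ?w r" for a r
      using T(1) by (simp add: orthogonal_transformation_def flip: T(2))
    from this[of _ 0] this[of _ t] have "T -` D s (s + t) = D 0 t"
      by (auto simp: D_def)
    then show ?thesis
      unfolding f_def
      by (subst distr_std_gaussian_orthogonal_transformation[OF T(1), symmetric])
        (simp add: measure_distr)
  qed
  have "f t = t / pi"
  proof (rule additive_complementary_eq_linear[OF _ _ _ t])
    show "0 \<le> f t" for t
      by (simp add: f_def)
    show "f (s + t) = f s + f t" if st: "0 \<le> s" "0 \<le> t" "s + t < pi" for s t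
    proof (cases "s = 0 \<or> t = 0")
      case True
      then show ?thesis by (auto simp: f_def D_def)
    next
      case False
      then have pos: "0 < sin s" "0 < sin t" "0 < sin (s + t)"
        using st by (auto intro!: sin_gt_zero)
      \<comment> \<open>As \<open>s + t < pi\<close>, the middle direction lies in the cone of the
        outer two: up to a positive factor it is their combination with coefficients
        \<open>sin t\<close> and \<open>sin s\<close>.\<close>
      have "sin (s + t) * cos s = sin t + sin s * cos (s + t)"
        using sin_diff[of "s + t" s] by (simp add: algebra_simps)
      then have "sin (s + t) *\<^sub>R ?w s = sin t *\<^sub>R ?w 0 + sin s *\<^sub>R ?w (s + t)"
        by (simp add: plane_dir_def scaleR_add_right algebra_simps flip: scaleR_add_left)
      then have comb: "sin (s + t) * (a \<bullet> ?w s) = sin t * (a \<bullet> ?w 0) + sin s * (a \<bullet> ?w (s + t))" for a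
        by (metis inner_add_right inner_scaleR_right)
      \<comment> \<open>The nonnegative and the negative half-line are both closed under positive
        combinations, so this holds for every \<open>a\<close>, not just almost surely.\<close>
      have "sign (a \<bullet> ?w s) = sign (a \<bullet> ?w 0)" if "sign (a \<bullet> ?w 0) = sign (a \<bullet> ?w (s + t))" for a
      proof (cases "a \<bullet> ?w 0 \<ge> 0")
        case True
        with that have "a \<bullet> ?w (s + t) \<ge> 0"
          by (auto simp: sign_def split: if_splits)
        with True pos have "0 \<le> sin (s + t) * (a \<bullet> ?w s)"
          unfolding comb by simp
        with True pos show ?thesis
          by (simp add: sign_def zero_le_mult_iff)
      next
        case False
        with that have "a \<bullet> ?w (s + t) < 0"
          by (auto simp: sign_def split: if_splits)
        with False pos have "sin (s + t) * (a \<bullet> ?w s) < 0"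
          unfolding comb by (intro add_neg_neg mult_pos_neg) auto
        with False pos show ?thesis
          by (simp add: sign_def mult_less_0_iff)
      qed
      then have union: "D 0 (s + t) = D 0 s \<union> D s (s + t)"
        unfolding D_def by force
      \<comment> \<open>With two sign values, two successive changes cancel.\<close>
      have "D 0 s \<inter> D s (s + t) \<subseteq> - D 0 (s + t)"
        by (auto simp: D_def sign_def split: if_splits)
      with union have "D 0 s \<inter> D s (s + t) = {}"
        by auto
      then show ?thesis
        using rotate[of s t] by (simp add: f_def union finite_measure_Union)
    qed
    show "f t + f (pi - t) = 1" if "0 \<le> t" "t \<le> pi" for t
    proof -
      have "u \<noteq> 0" using uv(1) by auto
      then have "AE a in std_gaussian. a \<bullet> u \<noteq> 0"
        by (rule AE_std_gaussian_inner_nonzero)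
      \<comment> \<open>The direction at angle \<open>pi\<close> is \<open>- u\<close>, whose sign
        is almost surely opposite to that of \<open>u\<close>; disagreeing with one means agreeing
        with the other.\<close>
      then have "AE a in std_gaussian. a \<in> D t pi \<longleftrightarrow> a \<in> space std_gaussian - D 0 t"
      proof eventually_elim
        case (elim a)
        then show ?case
          by (auto simp: D_def w0 wpi sign_uminus) (auto simp: sign_def split: if_splits)
      qed
      then have "prob (D t pi) = prob (space std_gaussian - D 0 t)"
        by (intro finite_measure_eq_AE) auto
      then show ?thesis
        using rotate[of t "pi - t"] prob_compl[of "D 0 t"] by (simp add: f_def)
    qed
  qed
  then show ?thesis
    by (simp add: f_def D_def w0)
qed

text \<open>Gram-Schmidt: \<open>v\<close> is the normalised part of \<open>w\<close> orthogonal to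
  \<open>u\<close>, whose length is the sine of the angle.\<close>

lemma unit_vector_eq_plane_dir:
  fixes u w :: "'a::euclidean_space"
  assumes dim: "2 \<le> DIM('a)" and u: "norm u = 1" and w: "norm w = 1"
  obtains v where "norm v = 1" "u \<bullet> v = 0" "w = plane_dir u v (arccos (u \<bullet> w))"
proof -
  have uu: "u \<bullet> u = 1" and ww: "w \<bullet> w = 1"
    using u w by (simp_all add: norm_eq_1)
  define c where "c = u \<bullet> w"
  have c: "\<bar>c\<bar> \<le> 1"
    using Cauchy_Schwarz_ineq2[of u w] u w by (simp add: c_def)
  define y where "y = w - c *\<^sub>R u"
  have uy: "u \<bullet> y = 0"
    by (simp add: y_def inner_diff_right uu c_def)
  have "y \<bullet> y = 1 - c\<^sup>2"
    by (simp add: y_def inner_diff_left inner_diff_right uu ww c_def inner_commute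
        power2_eq_square)
  then have ny: "norm y = sin (arccos c)"
    using c by (simp add: norm_eq_sqrt_inner sin_arccos_abs)
  have cos: "cos (arccos c) = c"
    using c by (simp add: cos_arccos_abs)
  show thesis
  proof (cases "y = 0")
    case True
    \<comment> \<open>Here \<open>w\<close> is a multiple of \<open>u\<close> and the sine is 0, so
      any unit vector orthogonal to \<open>u\<close> serves; dimension at least 2 provides
      one.\<close>
    obtain v where "v \<noteq> 0" "orthogonal u v"
      using orthogonal_to_vector_exists[OF dim] by metis
    then show thesis
      using True ny cos
      by (intro that[of "v /\<^sub>R norm v"])
        (auto simp: orthogonal_def plane_dir_def y_def c_def)
  next
    case False
    then have "0 < sin (arccos c)"
      by (simp flip: ny)
    then show thesis
      using uy ny cos
      by (intro that[of "y /\<^sub>R norm y"])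
        (auto simp: plane_dir_def y_def simp flip: c_def)
  qed
qed

lemma measure_sign_agree:
  fixes u w :: "real ^ 'n"
  assumes "2 \<le> CARD('n)" and u: "norm u = 1" and w: "norm w = 1"
  shows "measure std_gaussian {a. sign (a \<bullet> u) = sign (a \<bullet> w)} = 1 - arccos (u \<bullet> w) / pi"
proof -
  interpret prob_space "std_gaussian :: (real ^ 'n) measure"
    by (rule prob_space_std_gaussian)
  have "2 \<le> DIM(real ^ 'n)"
    using assms(1) by simp
  then obtain v where v: "norm v = 1" "u \<bullet> v = 0" "w = plane_dir u v (arccos (u \<bullet> w))"
    using unit_vector_eq_plane_dir[OF _ u w] by blast
  have "\<bar>u \<bullet> w\<bar> \<le> 1"
    using Cauchy_Schwarz_ineq2[of u w] u w by simp
  then have "prob {a. sign (a \<bullet> u) \<noteq> sign (a \<bullet> w)} = arccos (u \<bullet> w) / pi"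
    using measure_sign_disagree[OF u v(1,2), of "arccos (u \<bullet> w)"]
    by (simp add: arccos_lbound arccos_ubound abs_le_iff flip: v(3))
  moreover have "{a. sign (a \<bullet> u) \<noteq> sign (a \<bullet> w)} \<in> events"
    by measurable
  ultimately have "prob (space std_gaussian - {a. sign (a \<bullet> u) \<noteq> sign (a \<bullet> w)})
      = 1 - arccos (u \<bullet> w) / pi"
    by (subst prob_compl) auto
  also have "space std_gaussian - {a. sign (a \<bullet> u) \<noteq> sign (a \<bullet> w)}
      = {a. sign (a \<bullet> u) = sign (a \<bullet> w)}"
    by auto
  finally show ?thesis .
qed

section \<open>The embedding into the sphere and the law of SIMPLE-LSH\<close>

lemma inner_vec_concat:
  fixes u u' :: "real ^ 'm" and v v' :: "real ^ 'n"
  shows "vec_concat u v \<bullet> vec_concat u' v' = u \<bullet> u' + v \<bullet> v'"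
proof -
  have "sum g UNIV = (\<Sum>j\<in>UNIV. g (Inl j)) + (\<Sum>k\<in>UNIV. g (Inr k))"
    for g :: "'m + 'n \<Rightarrow> real"
    using sum.Plus[of "UNIV :: 'm set" "UNIV :: 'n set" g] by simp
  then show ?thesis
    by (simp add: vec_concat_def inner_vec_def)
qed

text \<open>The extra term vanishes once one argument has norm 1; for equal arguments in the unit
  ball it completes the squared norm to 1.\<close>

lemma inner_simple_P:
  "simple_P x \<bullet> simple_P y = x \<bullet> y + sqrt (1 - (norm x)\<^sup>2) * sqrt (1 - (norm y)\<^sup>2)"
  unfolding simple_P_def inner_vec_concat by (simp add: inner_vec_def[of "vec _"])

lemma norm_simple_P: "norm x \<le> 1 \<Longrightarrow> norm (simple_P x) = 1"
  unfolding norm_eq_1 inner_simple_P by (simp add: power_le_one flip: power2_norm_eq_inner)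

lemma simple_hash_measurable [measurable]:
  "(simple_hash :: real ^ ('d + 1) \<Rightarrow> real ^ 'd \<Rightarrow> int)
    \<in> borel \<rightarrow>\<^sub>M (\<Pi>\<^sub>M x\<in>cball 0 1. count_space {- 1, 1})"
proof -
  have "(\<lambda>a :: real ^ ('d + 1). sign (a \<bullet> simple_P x)) \<in> borel \<rightarrow>\<^sub>M count_space {- 1, 1}"
    for x :: "real ^ 'd"
    \<comment> \<open>Measurability into all integers restricts to the alphabet, since both values
      of \<open>sign\<close> lie in it.\<close>
    by (rule measurable_count_space_extend[of _ UNIV]) (auto simp: sign_def)
  then show ?thesis
    unfolding simple_hash_def by (intro measurable_restrict)
qed

text \<open>Splitting by the common value \<open>i\<close> gives a countable union of events that
  each fix two coordinates.\<close>

lemma collision_sets: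
  fixes x y :: "real ^ 'd"
  assumes "x \<in> cball 0 1" "y \<in> cball 0 1"
  shows "{h \<in> space simple_LSH. h x = h y} \<in> sets simple_LSH"
proof -
  have coord: "(\<lambda>h. h z) -` {i} \<inter> space simple_LSH \<in> sets simple_LSH"
    if z: "z \<in> cball 0 1" for z :: "real ^ 'd" and i
  proof (rule measurable_sets)
    show "(\<lambda>h. h z) \<in> simple_LSH \<rightarrow>\<^sub>M count_space UNIV"
    proof (rule measurable_compose)
      show "(\<lambda>h. h z) \<in> simple_LSH \<rightarrow>\<^sub>M count_space {- 1, 1}"
        using measurable_component_singleton[OF z, of "\<lambda>_. count_space {- 1, 1}"]
        by (simp add: simple_LSH_def)
    qed simp
  qed simp
  have "{h \<in> space simple_LSH. h x = h y} =
      (\<Union>i::int. ((\<lambda>h. h x) -` {i} \<inter> space simple_LSH) \<inter> ((\<lambda>h. h y) -` {i} \<inter> space simple_LSH))"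
    by auto
  also have "\<dots> \<in> sets simple_LSH"
    by (intro sets.countable_UN'' sets.Int coord assms) simp
  finally show ?thesis .
qed

lemma is_hash_simple_LSH: "is_hash (cball 0 1) simple_LSH"
proof -
  have "prob_space simple_LSH"
    unfolding simple_LSH_def
    by (rule prob_space.prob_space_distr[OF prob_space_std_gaussian]) measurable
  moreover have "space simple_LSH = cball 0 1 \<rightarrow>\<^sub>E {- 1, 1}"
    by (simp add: simple_LSH_def space_PiM)
  ultimately show ?thesis
    unfolding is_hash_def using collision_sets by blast
qed

lemma collision_prob_simple_LSH:
  fixes x y :: "real ^ 'd"
  assumes "norm x \<le> 1" "norm y = 1"
  shows "\<P>(h in simple_LSH. h x = h y) = 1 - arccos (x \<bullet> y) / pi"
proof -
  have xy: "x \<in> cball 0 1" "y \<in> cball 0 1"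
    using assms by auto
  have "\<P>(h in simple_LSH. h x = h y)
      = measure std_gaussian (simple_hash -` {h \<in> space simple_LSH. h x = h y} \<inter> space std_gaussian)"
    using collision_sets[OF xy] unfolding simple_LSH_def
    by (subst measure_distr) auto
  also have "simple_hash -` {h \<in> space simple_LSH. h x = h y} \<inter> space std_gaussian
      = {a. sign (a \<bullet> simple_P x) = sign (a \<bullet> simple_P y)}"
    using xy measurable_space[OF simple_hash_measurable[where 'd = 'd]]
    by (auto simp: simple_LSH_def) (auto simp: simple_hash_def)
  \<comment> \<open>The embedding has \<open>CARD('d) + 1\<close> coordinates, hence at least the
    two that \<open>measure_sign_agree\<close> demands.\<close>
  also have "measure std_gaussian \<dots> = 1 - arccos (simple_P x \<bullet> simple_P y) / pi"
    using assms by (intro measure_sign_agree norm_simple_P) (auto simp: card_UNIV_sum)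
  also have "simple_P x \<bullet> simple_P y = x \<bullet> y"
    using assms by (simp add: inner_simple_P)
  finally show ?thesis .
qed

section \<open>From the collision probability to thresholds and hashing quality\<close>

theorem theorem4p2:
  shows "universal_LSH (cball 0 1) (simple_LSH :: (real ^ 'd \<Rightarrow> int) measure)
           (\<lambda>x q. x \<bullet> q) (cball 0 1) (sphere 0 1) \<and>
         (\<forall>S c :: real. 0 < S \<and> S < 1 \<and> 0 < c \<and> c < 1 \<longrightarrow>
           has_hashing_quality (cball 0 1) (simple_LSH :: (real ^ 'd \<Rightarrow> int) measure)
             (\<lambda>x q. x \<bullet> q) (cball 0 1) (sphere 0 1) S (c * S)
             (ln (1 - arccos S / pi) / ln (1 - arccos (c * S) / pi)))"
proof -
  \<comment> \<open>The collision probability at inner product \<open>r\<close>; the witnesses are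
    its values at the two thresholds, \<open>p S\<close> and \<open>p (c * S)\<close>.\<close>
  define p where "p = (\<lambda>r. 1 - arccos r / pi)"
  have p_mono: "p r \<le> p s" if "- 1 \<le> r" "r \<le> s" "s \<le> 1" for r s
    using that by (simp add: p_def arccos_le_arccos divide_right_mono)
  have p_bounds: "p r \<in> {0..1}" if "- 1 \<le> r" "r \<le> 1" for r
    using that by (simp add: p_def arccos_lbound arccos_ubound)
  have main: "p (c * S) < p S" "p (c * S) > 0" "p S \<in> {0..1}" "p (c * S) \<in> {0..1}"
    "is_LSH_with (cball 0 1) (simple_LSH :: (real ^ 'd \<Rightarrow> int) measure)
      (\<lambda>x q. x \<bullet> q) (cball 0 1) (sphere 0 1) S (c * S) (p S) (p (c * S))"
    if "0 < S" "S < 1" "0 < c" "c < 1" for S c :: real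
  proof -
    have cS: "0 < c * S" "c * S < S" "c * S < 1"
      using that by (auto intro: mult_less_cancel_right1[THEN iffD2] less_trans[of _ S])
    show "p S \<in> {0..1}" "p (c * S) \<in> {0..1}"
      using cS that p_bounds[of S] p_bounds[of "c * S"] by linarith+
    show "p (c * S) < p S"
      using arccos_less_arccos[of "c * S" S] cS that unfolding p_def
      by (intro diff_strict_left_mono divide_strict_right_mono) auto
    \<comment> \<open>Strictness, from \<open>c * S > - 1\<close>, keeps the smaller probability
      positive and its logarithm meaningful.\<close>
    have "arccos (c * S) < pi"
      using arccos_less_arccos[of "- 1" "c * S"] cS by simp
    then show "p (c * S) > 0"
      by (simp add: p_def)
    have "(S \<le> x \<bullet> q \<longrightarrow> p S \<le> \<P>(h in simple_LSH. h x = h q)) \<and>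
        (x \<bullet> q \<le> c * S \<longrightarrow> \<P>(h in simple_LSH. h x = h q) \<le> p (c * S))"
      if "x \<in> cball 0 1" "q \<in> sphere 0 1" for x q :: "real ^ 'd"
    proof -
      have xq: "norm x \<le> 1" "norm q = 1"
        using that by auto
      \<comment> \<open>This places the inner product in the interval on which \<open>p\<close> is
        monotone.\<close>
      then have "\<bar>x \<bullet> q\<bar> \<le> 1"
        using Cauchy_Schwarz_ineq2[of x q] by simp
      then have "S \<le> x \<bullet> q \<longrightarrow> p S \<le> p (x \<bullet> q)" "x \<bullet> q \<le> c * S \<longrightarrow> p (x \<bullet> q) \<le> p (c * S)"
        using p_mono[of S "x \<bullet> q"] p_mono[of "x \<bullet> q" "c * S"] cS \<open>0 < S\<close> by linarith+
      moreover have "\<P>(h in simple_LSH. h x = h q) = p (x \<bullet> q)"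
        using collision_prob_simple_LSH[OF xq] by (simp add: p_def)
      ultimately show ?thesis
        by simp
    qed
    then show "is_LSH_with (cball 0 1) (simple_LSH :: (real ^ 'd \<Rightarrow> int) measure)
      (\<lambda>x q. x \<bullet> q) (cball 0 1) (sphere 0 1) S (c * S) (p S) (p (c * S))"
      unfolding is_LSH_with_def using is_hash_simple_LSH by auto
  qed
  show ?thesis
    unfolding universal_LSH_def is_LSH_def has_hashing_quality_def
  proof (intro conjI allI impI)
    fix S c :: real
    assume "0 < S \<and> S < 1 \<and> 0 < c \<and> c < 1"
    then have Sc: "0 < S" "S < 1" "0 < c" "c < 1" by auto
    show "\<exists>p1\<in>{0..1}. \<exists>p2\<in>{0..1}. p2 < p1 \<and>
        is_LSH_with (cball 0 1) (simple_LSH :: (real ^ 'd \<Rightarrow> int) measure)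
          (\<lambda>x q. x \<bullet> q) (cball 0 1) (sphere 0 1) S (c * S) p1 p2"
      by (rule bexI[of _ "p S"], rule bexI[of _ "p (c * S)"]) (use main[OF Sc] in simp_all)
    show "\<exists>p1\<in>{0..1}. \<exists>p2\<in>{0..1}. p2 < p1 \<and> 0 < p2 \<and>
        is_LSH_with (cball 0 1) (simple_LSH :: (real ^ 'd \<Rightarrow> int) measure)
          (\<lambda>x q. x \<bullet> q) (cball 0 1) (sphere 0 1) S (c * S) p1 p2 \<and>
        ln p1 / ln p2 = ln (1 - arccos S / pi) / ln (1 - arccos (c * S) / pi)"
      by (rule bexI[of _ "p S"], rule bexI[of _ "p (c * S)"])
        (use main[OF Sc] in \<open>simp_all add: p_def\<close>)
  qed
qed

end
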